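(* Let $A, B \in M_2(\bar{\mathbb{R}})$. Then the following are equivalent: (i) $A \leq_{\mathcal{J}} B$; (ii) $PC(A)$ embeds isometrically in $PC(B)$; (iii) $PR(A)$ embeds isometrically in $PR(B)$.
   Context: $\bar{\mathbb{R}} = \mathbb{R} \cup \{-\infty\}$ is the tropical semiring with $a \otimes b = a+b$ (with $-\infty$ absorbing) and $a \oplus b = \max\{a,b\}$. $M_2(\bar{\mathbb{R}})$ is the monoid of $2 \times 2$ matrices over $\bar{\mathbb{R}}$ under tropical matrix multiplication $(AB)_{ij} = \max_{k} (A_{ik} + B_{kj})$. In a monoid $S$, $A \leq_{\mathcal{J}} B$ means $SAS \subseteq SBS$. The column space $C(A)$ (respectively row space $R(A)$) is the set of all tropical linear combinations in $\bar{\mathbb{R}}^2$ of the columns (respectively rows) of $A$. Let $\hat{\mathbb{R}} = \mathbb{R} \cup \{-\infty,\infty\}$. Each non-zero vector $(a,b) \in \bar{\mathbb{R}}^2$ (i.e. $(a,b)\neq(-\infty,-\infty)$) is projected to the point of $\hat{\mathbb{R}}$ equal to $b-a$ if $a,b$ are real, $\infty$ if $a=-\infty$, and $-\infty$ if $b=-\infty$. $PC(A), PR(A) \subseteq \hat{\mathbb{R}}$ are the images under this projection of the non-zero vectors of $C(A)$ and $R(A)$ respectively. The distance $\delta$ on $\hat{\mathbb{R}}$ (with values in $\mathbb{R}\cup\{\infty\}$) is $\delta(x,y) = |y-x|$ if $x,y \in \mathbb{R}$; $\delta(x,y)=0$ if $x=y=-\infty$ or $x=y=\infty$; and $\delta(x,y)=\infty$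 otherwise. An isometric embedding of $M\subseteq\hat{\mathbb{R}}$ in $N \subseteq\hat{\mathbb{R}}$ is a map $M \to N$ preserving $\delta$ (not required to preserve orientation). *)

theory Defs
  imports "HOL-Analysis.Analysis"
begin

text \<open>The tropical (max-plus) semiring. Its semiring operations are installed as
  \<open>+\<close> (maximum) and \<open>*\<close> (real addition, with \<open>NegInf\<close> absorbing), so that the
  library's matrix product \<open>**\<close> on \<open>tropical^2^2\<close> is the tropical matrix product;
  thus \<open>0\<close> is \<open>NegInf\<close> and \<open>1\<close> is \<open>Fin 0\<close>.\<close>

datatype tropical = NegInf | Fin real

instantiation tropical :: comm_semiring_1
begin

definition zero_tropical :: tropical where
  "0 = NegInf"

definition one_tropical :: tropical where
  "1 = Fin 0"

fun plus_tropical :: "tropical \<Rightarrow> tropical \<Rightarrow> tropical" where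
  "NegInf + y = y"
| "Fin a + NegInf = Fin a"
| "Fin a + Fin b = Fin (max a b)"

fun times_tropical :: "tropical \<Rightarrow> tropical \<Rightarrow> tropical" where
  "NegInf * y = NegInf"
| "Fin a * NegInf = NegInf"
| "Fin a * Fin b = Fin (a + b)"

instance
proof
  fix a b c :: tropical
  show "a + b + c = a + (b + c)"
    by (cases a; cases b; cases c) auto
  show "a + b = b + a"
    by (cases a; cases b) auto
  show "0 + a = a"
    by (simp add: zero_tropical_def)
  show "a * b * c = a * (b * c)"
    by (cases a; cases b; cases c) auto
  show "a * b = b * a"
    by (cases a; cases b) auto
  show "1 * a = a"
    by (cases a) (auto simp: one_tropical_def)
  show "(a + b) * c = a * c + b * c"
    by (cases a; cases b; cases c) auto
  show "0 * a = 0" and "a * 0 = 0"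
    by (cases a; simp add: zero_tropical_def)+
  show "(0 :: tropical) \<noteq> 1"
    by (simp add: zero_tropical_def one_tropical_def)
qed

end

definition two_sided_multiples :: "'a::semiring_1^'n^'n \<Rightarrow> ('a^'n^'n) set" where
  "two_sided_multiples A = {P ** A ** Q | P Q. True}"

definition J_le :: "'a::semiring_1^'n^'n \<Rightarrow> 'a^'n^'n \<Rightarrow> bool" where
  "J_le A B \<longleftrightarrow> two_sided_multiples A \<subseteq> two_sided_multiples B"

definition column_space :: "'a::semiring_1^'n^'m \<Rightarrow> ('a^'m) set" where
  "column_space A = {\<Sum>j\<in>UNIV. c j *s column j A | c. True}"

definition row_space :: "'a::semiring_1^'n^'m \<Rightarrow> ('a^'n) set" where
  "row_space A = {\<Sum>i\<in>UNIV. c i *s row i A | c. True}"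

text \<open>The projection is only meaningful on non-zero vectors; the last case is a dummy value.\<close>

definition proj :: "tropical^2 \<Rightarrow> ereal" where
  "proj v = (case (v $ 1, v $ 2) of
      (Fin a, Fin b) \<Rightarrow> ereal (b - a)
    | (NegInf, Fin b) \<Rightarrow> \<infinity>
    | (Fin a, NegInf) \<Rightarrow> - \<infinity>
    | (NegInf, NegInf) \<Rightarrow> undefined)"

definition PC :: "tropical^2^2 \<Rightarrow> ereal set" where
  "PC A = proj ` (column_space A - {0})"

definition PR :: "tropical^2^2 \<Rightarrow> ereal set" where
  "PR A = proj ` (row_space A - {0})"

text \<open>Unlike \<open>\<bar>y - x\<bar>\<close> in \<^typ>\<open>ereal\<close>, this distance is \<open>0\<close> between equal infinite points.\<close>

definition delta :: "ereal \<Rightarrow> ereal \<Rightarrow> ereal" where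
  "delta x y = (case (x, y) of
      (ereal a, ereal b) \<Rightarrow> ereal \<bar>b - a\<bar>
    | _ \<Rightarrow> if x = y then 0 else \<infinity>)"

definition embeds_isometrically :: "ereal set \<Rightarrow> ereal set \<Rightarrow> bool" where
  "embeds_isometrically M N \<longleftrightarrow>
     (\<exists>f. f \<in> M \<rightarrow> N \<and> (\<forall>x\<in>M. \<forall>y\<in>M. delta (f x) (f y) = delta x y))"

end

theory Submission
  imports Defs
begin

text \<open>Every tropical two by two matrix can be brought into a normal form: \<open>0\<close>, the identity, or
  a matrix \<open>chain_form t\<close> with rows \<open>(1, 1)\<close> and \<open>(t, 1)\<close>, where \<open>t + 1 = 1\<close> says that \<open>t\<close> is at
  most the tropical unit. The moves are permutation and finite scaling of rows and columns, and
  the replacement of one matrix of rank one by another. Each move keeps the matrix in its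
  \<open>\<J>\<close>-class. On the projected column space a row permutation acts by negation and a row scaling
  by translation, whereas column moves fix it; rank one matrices have a single projected point.
  So each move changes neither \<open>PC\<close> nor \<open>PR\<close> up to mutual embeddability (lemma
  \<open>normal_form\<close>).

  For the normal forms \<open>PC\<close> is empty, the whole extended line, or the interval from \<open>t\<close> (read as
  an extended real) to \<open>0\<close>. A mutual embedding of \<open>PC A\<close> and \<open>PR A\<close>
  (\<open>PC_PR_mutually_embed\<close>) follows because the normal forms agree with their transposes up to
  permutations. It yields the forward implication: right multiplication shrinks \<open>PC\<close>, left
  multiplication shrinks \<open>PR\<close>, and one passes from one to the other.

  For the converse it suffices to look at normal forms. An embedding of one interval into another
  forces the source to be at most as long as the target. Its columns are then combinations of
  the target's columns, which exhibits it as a right multiple of the target. Finally the whole line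
  contains three points at pairwise infinite distance, while an interval ending at \<open>0\<close> does not,
  so the identity lies strictly above all other normal forms.\<close>

section \<open>Isometric embeddings\<close>

lemma delta_self [simp]: "delta x x = 0"
  by (cases x) (auto simp: delta_def zero_ereal_def)

lemma embeds_isometrically_trans [trans]:
  assumes "embeds_isometrically L M" and "embeds_isometrically M N"
  shows "embeds_isometrically L N"
proof -
  obtain f where f: "f \<in> L \<rightarrow> M" "\<And>x y. x \<in> L \<Longrightarrow> y \<in> L \<Longrightarrow> delta (f x) (f y) = delta x y"
    using assms(1) unfolding embeds_isometrically_def by blast
  obtain g where g: "g \<in> M \<rightarrow> N" "\<And>x y. x \<in> M \<Longrightarrow> y \<in> M \<Longrightarrow> delta (g x) (g y) = delta x y"
    using assms(2) unfolding embeds_isometrically_def by blast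
  have "(g \<circ> f) \<in> L \<rightarrow> N" and "\<forall>x\<in>L. \<forall>y\<in>L. delta ((g \<circ> f) x) ((g \<circ> f) y) = delta x y"
    using f g by (auto simp: Pi_iff)
  then show ?thesis
    unfolding embeds_isometrically_def by blast
qed

lemma embeds_isometrically_subset: "M \<subseteq> N \<Longrightarrow> embeds_isometrically M N"
  unfolding embeds_isometrically_def by (rule exI[of _ "\<lambda>x. x"]) auto

lemma embeds_isometrically_singleton: "N \<noteq> {} \<Longrightarrow> embeds_isometrically {x} N"
  unfolding embeds_isometrically_def by (auto simp: Pi_iff)

lemma delta_add_real: "delta (x + ereal c) (y + ereal c) = delta x y"
  by (cases x; cases y) (auto simp: delta_def)

lemma delta_uminus: "delta (- x) (- y) = delta x y"
  by (cases x; cases y) (auto simp: delta_def)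

section \<open>Column and row spaces of matrix products\<close>

lemma column_space_eq_range: "column_space A = range ((*v) A)"
  for A :: "'a::comm_semiring_1^'n^'m"
proof -
  have "(\<Sum>j\<in>UNIV. c j *s column j A) = A *v (\<chi> j. c j)" for c
    by (simp add: matrix_mult_sum)
  moreover have "A *v x = (\<Sum>j\<in>UNIV. (x $ j) *s column j A)" for x
    by (simp add: matrix_mult_sum)
  ultimately show ?thesis
    unfolding column_space_def by blast
qed

lemma row_space_eq_column_space_transpose: "row_space A = column_space (transpose A)"
  unfolding row_space_def column_space_def by (simp add: column_transpose)

lemma PR_eq_PC_transpose: "PR A = PC (transpose A)"
  unfolding PR_def PC_def row_space_eq_column_space_transpose ..

lemma PC_eq: "PC A = {proj (A *v x) | x. A *v x \<noteq> 0}"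
  unfolding PC_def column_space_eq_range by auto

lemma PC_mult_subset: "PC (A ** Q) \<subseteq> PC A"
  unfolding PC_eq by (auto simp: matrix_vector_mul_assoc[symmetric])

lemma PR_mult_subset: "PR (P ** A) \<subseteq> PR A"
  unfolding PR_eq_PC_transpose matrix_transpose_mul by (rule PC_mult_subset)

lemma J_le_iff: "J_le A B \<longleftrightarrow> (\<exists>P Q. A = P ** B ** Q)"
proof
  assume "J_le A B"
  moreover have "A \<in> two_sided_multiples A"
    unfolding two_sided_multiples_def
    by simp (metis matrix_mul_lid matrix_mul_rid)
  ultimately show "\<exists>P Q. A = P ** B ** Q"
    unfolding J_le_def two_sided_multiples_def by blast
next
  assume "\<exists>P Q. A = P ** B ** Q"
  then obtain P Q where A: "A = P ** B ** Q" by blast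
  have "X ** A ** Y = (X ** P) ** B ** (Q ** Y)" for X Y
    unfolding A by (simp add: matrix_mul_assoc)
  then show "J_le A B"
    unfolding J_le_def two_sided_multiples_def by blast
qed

lemma J_le_mult: "J_le (P ** A ** Q) A"
  unfolding J_le_iff by blast

lemma J_le_trans [trans]: "J_le A B \<Longrightarrow> J_le B C \<Longrightarrow> J_le A C"
  unfolding J_le_def by blast

lemma J_le_transpose:
  fixes A B :: "'a::comm_semiring_1^'n^'n"
  assumes "J_le A B"
  shows "J_le (transpose A) (transpose B)"
  using assms unfolding J_le_iff by (metis matrix_transpose_mul matrix_mul_assoc)

section \<open>Two by two matrices\<close>

definition mat2 :: "'a \<Rightarrow> 'a \<Rightarrow> 'a \<Rightarrow> 'a \<Rightarrow> 'a^2^2" where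
  "mat2 a b c d = (\<chi> i j. if i = 1 then (if j = 1 then a else b) else (if j = 1 then c else d))"

lemma mat2_nth [simp]:
  "mat2 a b c d $ 1 $ 1 = a" "mat2 a b c d $ 1 $ 2 = b"
  "mat2 a b c d $ 2 $ 1 = c" "mat2 a b c d $ 2 $ 2 = d"
  by (simp_all add: mat2_def)

lemma mat2_cases: obtains a b c d where "A = mat2 a b c d"
proof
  show "A = mat2 (A $ 1 $ 1) (A $ 1 $ 2) (A $ 2 $ 1) (A $ 2 $ 2)"
    by (simp add: vec_eq_iff forall_2)
qed

lemma mat2_mult:
  fixes a :: "'a::semiring_1"
  shows "mat2 a b c d ** mat2 e f g h
    = mat2 (a * e + b * g) (a * f + b * h) (c * e + d * g) (c * f + d * h)"
  by (simp add: vec_eq_iff forall_2 matrix_matrix_mult_def sum_2)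

lemma mat2_mult_vec:
  fixes a :: "'a::semiring_1"
  shows "(mat2 a b c d *v x) $ 1 = a * x $ 1 + b * x $ 2"
    "(mat2 a b c d *v x) $ 2 = c * x $ 1 + d * x $ 2"
  by (simp_all add: matrix_vector_mult_def sum_2)

lemma transpose_mat2: "transpose (mat2 a b c d) = mat2 a c b d"
  by (simp add: vec_eq_iff forall_2 transpose_def)

lemma mat_1_eq_mat2: "mat 1 = mat2 1 0 0 1"
  by (simp add: vec_eq_iff forall_2 mat_def)

lemma zero_eq_mat2: "0 = mat2 0 0 0 0"
  by (simp add: vec_eq_iff forall_2)

lemma vec2_nonzero: "v \<noteq> 0 \<longleftrightarrow> v $ 1 \<noteq> 0 \<or> v $ (2::2) \<noteq> 0"
  by (simp add: vec_eq_iff forall_2)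

lemma tropical_add_self [simp]: "x + x = (x::tropical)"
  by (cases x) auto

lemma tropical_nonzero_iff: "x \<noteq> 0 \<longleftrightarrow> (\<exists>r. x = Fin r)"
  by (cases x) (auto simp: zero_tropical_def)

section \<open>Equivalence of matrices\<close>

text \<open>The conditions on columns and rows are carried along together so that the relation is
  invariant under transposition: row moves then give column moves for free.\<close>

definition below :: "tropical^2^2 \<Rightarrow> tropical^2^2 \<Rightarrow> bool" where
  "below A B \<longleftrightarrow> J_le A B \<and> embeds_isometrically (PC A) (PC B) \<and> embeds_isometrically (PR A) (PR B)"

definition equivalent :: "tropical^2^2 \<Rightarrow> tropical^2^2 \<Rightarrow> bool" (infix "\<sim>" 50) where
  "A \<sim> B \<longleftrightarrow> below A B \<and> below B A"

lemma equivalent_refl: "A \<sim> A"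
  unfolding equivalent_def below_def
  by (auto intro: embeds_isometrically_subset simp: J_le_def)

lemma equivalent_sym: "A \<sim> B \<Longrightarrow> B \<sim> A"
  unfolding equivalent_def by blast

lemma equivalent_trans [trans]: "A \<sim> B \<Longrightarrow> B \<sim> C \<Longrightarrow> A \<sim> C"
  unfolding equivalent_def below_def
  by (meson embeds_isometrically_trans J_le_trans)

lemma equivalent_transpose: "A \<sim> B \<Longrightarrow> transpose A \<sim> transpose B"
  unfolding equivalent_def below_def PR_eq_PC_transpose
  by (auto simp: J_le_transpose)

text \<open>The infinite points are included, and non-zero vectors must stay non-zero, so that \<open>f\<close> maps
  the projected column space of any \<open>A\<close> into that of \<open>U ** A\<close>.\<close>

definition acts_isometrically :: "tropical^2^2 \<Rightarrow> bool" where
  "acts_isometrically U \<longleftrightarrow> (\<exists>f. (\<forall>v. v \<noteq> 0 \<longrightarrow> U *v v \<noteq> 0 \<and> proj (U *v v) = f (proj v)) \<and>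
     (\<forall>x y. delta (f x) (f y) = delta x y))"

lemma PC_embeds_if_acts_isometrically:
  assumes "acts_isometrically U"
  shows "embeds_isometrically (PC A) (PC (U ** A))"
proof -
  obtain f where f: "\<And>v. v \<noteq> 0 \<Longrightarrow> U *v v \<noteq> 0 \<and> proj (U *v v) = f (proj v)"
    "\<And>x y. delta (f x) (f y) = delta x y"
    using assms unfolding acts_isometrically_def by blast
  have "f (proj (A *v x)) \<in> PC (U ** A)" if "A *v x \<noteq> 0" for x
    using f(1)[OF that] unfolding PC_eq
    by (auto simp: matrix_vector_mul_assoc[symmetric] intro!: exI[of _ x])
  then have "f \<in> PC A \<rightarrow> PC (U ** A)"
    by (auto simp: PC_eq[of A])
  then show ?thesis
    using f(2) unfolding embeds_isometrically_def by blast
qed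

text \<open>The row space only shrinks under left multiplication, whereas the column space is moved to a
  different place; the inverse \<open>U'\<close> takes it back without changing distances.\<close>

lemma below_unit_mult:
  assumes "acts_isometrically U'" and "U' ** U = mat 1"
  shows "below (U ** A) A"
  unfolding below_def
proof (intro conjI)
  show "J_le (U ** A) A"
    using J_le_mult[of U A "mat 1"] by simp
  show "embeds_isometrically (PC (U ** A)) (PC A)"
    using PC_embeds_if_acts_isometrically[OF assms(1), of "U ** A"] assms(2)
    by (simp add: matrix_mul_assoc)
  show "embeds_isometrically (PR (U ** A)) (PR A)"
    by (intro embeds_isometrically_subset PR_mult_subset)
qed

lemma unit_mult_equivalent:
  assumes "acts_isometrically U" "acts_isometrically U'" "U' ** U = mat 1" "U ** U' = mat 1"
  shows "U ** A \<sim> A"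
  using below_unit_mult[OF assms(2,3), of A] below_unit_mult[OF assms(1,4), of "U ** A"] assms(3)
  by (simp add: equivalent_def matrix_mul_assoc)

lemma acts_isometrically_swap: "acts_isometrically (mat2 0 1 1 0)"
proof -
  have "proj (mat2 0 1 1 0 *v v) = - proj v" if "v \<noteq> 0" for v
    using that by (cases "v $ 1"; cases "v $ 2")
      (auto simp: proj_def mat2_mult_vec vec2_nonzero zero_tropical_def one_tropical_def)
  moreover have "mat2 0 1 1 0 *v v \<noteq> 0" if "v \<noteq> 0" for v :: "tropical^2"
    using that by (auto simp: mat2_mult_vec vec2_nonzero)
  ultimately show ?thesis
    unfolding acts_isometrically_def using delta_uminus by blast
qed

lemma acts_isometrically_diag: "acts_isometrically (mat2 (Fin a) 0 0 (Fin b))"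
proof -
  have "proj (mat2 (Fin a) 0 0 (Fin b) *v v) = proj v + ereal (b - a)" if "v \<noteq> 0" for v
    using that by (cases "v $ 1"; cases "v $ 2")
      (auto simp: proj_def mat2_mult_vec vec2_nonzero zero_tropical_def)
  moreover have "mat2 (Fin a) 0 0 (Fin b) *v v \<noteq> 0" if "v \<noteq> 0" for v :: "tropical^2"
    using that by (cases "v $ 1"; cases "v $ 2")
      (auto simp: mat2_mult_vec vec2_nonzero zero_tropical_def)
  ultimately show ?thesis
    unfolding acts_isometrically_def using delta_add_real by (intro exI[of _ "\<lambda>x. x + ereal (b - a)"]) auto
qed

lemma equivalent_swap_rows: "mat2 c d a b \<sim> mat2 a b c d"
  using unit_mult_equivalent[OF acts_isometrically_swap acts_isometrically_swap, of "mat2 a b c d"]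
  by (simp add: mat2_mult mat_1_eq_mat2)

lemma equivalent_scale_rows:
  "mat2 (Fin r * a) (Fin r * b) (Fin s * c) (Fin s * d) \<sim> mat2 a b c d"
proof -
  have "Fin x * Fin (- x) = 1" "Fin (- x) * Fin x = 1" for x
    by (simp_all add: one_tropical_def)
  then show ?thesis
    using unit_mult_equivalent[OF acts_isometrically_diag acts_isometrically_diag,
        of "- r" "- s" r s "mat2 a b c d"]
    by (simp add: mat2_mult mat_1_eq_mat2)
qed

lemma equivalent_swap_columns: "mat2 b a d c \<sim> mat2 a b c d"
  using equivalent_transpose[OF equivalent_swap_rows[of b d a c]] by (simp add: transpose_mat2)

lemma equivalent_scale_columns:
  "mat2 (Fin r * a) (Fin s * b) (Fin r * c) (Fin s * d) \<sim> mat2 a b c d"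
  using equivalent_transpose[OF equivalent_scale_rows[of r a c s b d]] by (simp add: transpose_mat2)

section \<open>Normal forms\<close>

text \<open>For \<open>t = 1\<close> this is a matrix of rank one; as \<open>t\<close> decreases to \<open>NegInf\<close> the interval
  \<open>PC (chain_form t)\<close> grows from a point to a ray with its infinite end point.\<close>

definition chain_form :: "tropical \<Rightarrow> tropical^2^2" where
  "chain_form t = mat2 1 1 t 1"

text \<open>All columns are multiples of \<open>(1, c)\<close>, and finite scaling does not affect the projection.\<close>

lemma PC_rank_one: "PC (mat2 1 b c (b * c)) = {proj (mat2 1 b c (b * c) *v axis 1 1)}"
proof -
  let ?A = "mat2 1 b c (b * c)"
  have "proj (?A *v x) = proj (?A *v axis 1 1)" if "?A *v x \<noteq> 0" for x
  proof -
    define l where "l = x $ 1 + b * x $ 2"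
    have l: "(?A *v x) $ 1 = l" "(?A *v x) $ 2 = l * c"
      by (simp_all add: l_def mat2_mult_vec algebra_simps)
    with that obtain r where r: "l = Fin r"
      by (metis vec2_nonzero tropical_nonzero_iff mult_zero_left)
    have "(?A *v axis 1 1) $ 1 = Fin 0" "(?A *v axis 1 1) $ 2 = c"
      by (simp_all add: mat2_mult_vec axis_def flip: one_tropical_def)
    then show ?thesis
      unfolding proj_def l r by (cases c) auto
  qed
  then have "PC ?A \<subseteq> {proj (?A *v axis 1 1)}"
    unfolding PC_eq by blast
  moreover have "?A *v axis 1 1 \<noteq> 0"
    by (simp add: vec2_nonzero mat2_mult_vec axis_def)
  then have "proj (?A *v axis 1 1) \<in> PC ?A"
    unfolding PC_eq by blast
  ultimately show ?thesis
    by blast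
qed

text \<open>Vanishing entries \<open>b\<close> or \<open>c\<close> cannot be made non-zero by permutations and finite
  scalings, hence the explicit, non-invertible multipliers.\<close>

lemma rank_one_equivalent: "mat2 1 b c (b * c) \<sim> chain_form 1"
proof -
  have 1: "chain_form 1 = mat2 1 1 1 (1 * 1)"
    by (simp add: chain_form_def)
  have "J_le (mat2 1 b c (b * c)) (chain_form 1)"
    using J_le_mult[of "mat2 1 0 0 c" "chain_form 1" "mat2 1 0 0 b"]
    by (simp add: chain_form_def mat2_mult mult.commute)
  moreover have "J_le (chain_form 1) (mat2 1 b c (b * c))"
    using J_le_mult[of "mat2 1 0 1 0" "mat2 1 b c (b * c)" "mat2 1 1 0 0"]
    by (simp add: chain_form_def mat2_mult)
  moreover have "embeds_isometrically (PC (mat2 1 b c (b * c))) (PC (mat2 1 b' c' (b' * c')))" for b c b' c'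
    unfolding PC_rank_one by (simp add: embeds_isometrically_singleton)
  moreover have "PR (mat2 1 b c (b * c)) = PC (mat2 1 c b (c * b))" for b c
    by (simp add: PR_eq_PC_transpose transpose_mat2 mult.commute)
  ultimately show ?thesis
    unfolding equivalent_def below_def 1 by presburger
qed

text \<open>The two terms of the tropical permanent agree precisely for rank at most one: after moving a
  finite entry to the top left corner and scaling it to \<open>1\<close>, the matrix is the product of its first
  column and its first row.\<close>

lemma singular_equivalent:
  assumes "a * d = b * c" and "mat2 a b c d \<noteq> 0"
  shows "mat2 a b c d \<sim> chain_form 1"
proof -
  have *: "mat2 (Fin r) b c d \<sim> chain_form 1" if "Fin r * d = b * c" for r b c d
  proof -
    have "Fin (- r) * Fin r = 1"
      by (simp add: one_tropical_def)
    moreover from this have "b * (Fin (- r) * c) = d"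
      using that by (metis mult.assoc mult.left_commute mult_1)
    ultimately have "mat2 1 b (Fin (- r) * c) (b * (Fin (- r) * c)) \<sim> mat2 (Fin r) b c d"
      using equivalent_scale_columns[of "- r" "Fin r" 0 b c d]
      by (simp add: one_tropical_def[symmetric] zero_tropical_def)
    then show ?thesis
      using rank_one_equivalent equivalent_sym equivalent_trans by blast
  qed
  consider r where "a = Fin r" | r where "b = Fin r" | r where "c = Fin r" | r where "d = Fin r"
    using assms(2) unfolding zero_eq_mat2 by (metis tropical_nonzero_iff)
  then show ?thesis
  proof cases
    case 1
    then show ?thesis
      using * assms(1) by simp
  next
    case (2 r)
    have "mat2 a b c d \<sim> mat2 b a d c"
      by (rule equivalent_swap_columns)
    also have "\<dots> \<sim> chain_form 1"
      using *[of r c a d] assms(1) 2 by simp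
    finally show ?thesis .
  next
    case (3 r)
    have "mat2 a b c d \<sim> mat2 c d a b"
      by (rule equivalent_swap_rows)
    also have "\<dots> \<sim> chain_form 1"
      using *[of r b d a] assms(1) 3 by (simp add: mult.commute)
    finally show ?thesis .
  next
    case (4 r)
    have "mat2 a b c d \<sim> mat2 b a d c"
      by (rule equivalent_swap_columns)
    also have "\<dots> \<sim> mat2 d c b a"
      by (rule equivalent_swap_rows)
    also have "\<dots> \<sim> chain_form 1"
      using *[of r a c b] assms(1) 4 by (simp add: mult.commute)
    finally show ?thesis .
  qed
qed

text \<open>Unless both off-diagonal entries vanish, one of them is scaled to \<open>1\<close>, using opposite scalings
  of the second row and the second column to preserve the diagonal. The product \<open>b * c\<close> is unchanged
  by this and therefore becomes the remaining entry.\<close>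

lemma unit_diagonal_equivalent:
  assumes "b * c + 1 = 1"
  shows "mat2 1 b c 1 \<sim> mat 1 \<or> (\<exists>t. t + 1 = 1 \<and> mat2 1 b c 1 \<sim> chain_form t)"
proof -
  have *: "mat2 1 (Fin r) c 1 \<sim> chain_form (Fin r * c)" for r c
  proof -
    have 1: "Fin 0 = 1" "Fin (- r) * Fin r = 1" "Fin r * Fin (- r) = 1"
      by (simp_all add: one_tropical_def)
    have "chain_form (Fin r * c) \<sim> mat2 1 1 c (Fin (- r))"
      using equivalent_scale_rows[of 0 1 1 r c "Fin (- r)"] by (simp add: chain_form_def 1)
    also have "\<dots> \<sim> mat2 1 (Fin r) c 1"
      using equivalent_scale_columns[of 0 1 "- r" "Fin r" c 1] by (simp add: 1)
    finally show ?thesis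
      by (rule equivalent_sym)
  qed
  consider "b = 0" "c = 0" | r where "b = Fin r" | r where "c = Fin r"
    by (metis tropical_nonzero_iff)
  then show ?thesis
  proof cases
    case 1
    then show ?thesis
      by (simp add: mat_1_eq_mat2 equivalent_refl)
  next
    case (2 r)
    then show ?thesis
      using *[of r c] assms by auto
  next
    case (3 r)
    have "mat2 1 b c 1 \<sim> mat2 b 1 1 c"
      by (rule equivalent_swap_columns)
    also have "\<dots> \<sim> mat2 1 c b 1"
      by (rule equivalent_swap_rows)
    finally show ?thesis
      using 3 *[of r b] assms equivalent_trans by (metis mult.commute)
  qed
qed

text \<open>When the diagonal term dominates the permanent, both diagonal entries are finite and row
  scalings turn them into \<open>1\<close>.\<close>

lemma nonsingular_equivalent:
  assumes "b * c + a * d = a * d" and "a * d \<noteq> 0"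
  shows "mat2 a b c d \<sim> mat 1 \<or> (\<exists>t. t + 1 = 1 \<and> mat2 a b c d \<sim> chain_form t)"
proof -
  obtain r s where [simp]: "a = Fin r" "d = Fin s"
    using assms(2) by (metis mult_zero_left mult_zero_right tropical_nonzero_iff)
  let ?b = "Fin (- r) * b" and ?c = "Fin (- s) * c"
  have "mat2 1 ?b ?c 1 \<sim> mat2 a b c d"
    using equivalent_scale_rows[of "- r" a b "- s" c d] by (simp add: one_tropical_def)
  moreover have "?b * ?c + 1 = 1"
    using assms(1) by (cases b; cases c) (auto simp: one_tropical_def max_def split: if_splits)
  ultimately show ?thesis
    using unit_diagonal_equivalent[of ?b ?c] equivalent_sym equivalent_trans by blast
qed

text \<open>The larger term of the permanent is moved to the diagonal by a column swap.\<close>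

lemma normal_form:
  obtains "A = 0" | "A \<sim> mat 1" | t where "t + 1 = 1" "A \<sim> chain_form t"
proof -
  obtain a b c d where A: "A = mat2 a b c d"
    by (rule mat2_cases)
  have total: "x + y = x \<or> x + y = y" for x y :: tropical
    by (cases x; cases y) (auto simp: max_def)
  consider "A = 0" | "A \<noteq> 0" "a * d = b * c"
    | "b * c + a * d = a * d" "a * d \<noteq> 0" | "a * d + b * c = b * c" "b * c \<noteq> 0"
    using total[of "a * d" "b * c"] by (metis add.commute add_0)
  then show ?thesis
  proof cases
    case 1
    then show ?thesis by (rule that(1))
  next
    case 2
    then have "A \<sim> chain_form 1"
      unfolding A by (simp add: singular_equivalent)
    then show ?thesis
      by (rule that(3)[rotated]) simp
  next
    case 3
    then show ?thesis
      using nonsingular_equivalent that(2,3) unfolding A by blast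
  next
    case 4
    then show ?thesis
      using nonsingular_equivalent[of a d b c] equivalent_swap_columns[of a b c d]
        equivalent_trans equivalent_sym that(2,3) unfolding A by blast
  qed
qed

section \<open>Projected column spaces of the normal forms\<close>

lemma PC_zero: "PC 0 = {}"
  by (simp add: PC_eq)

lemma infinite_points_in_PC_mat_1: "{- \<infinity>, 0, \<infinity>} \<subseteq> PC (mat 1)"
proof -
  have "proj (vector [1, 0]) = - \<infinity>" "proj (vector [1, 1]) = 0" "proj (vector [0, 1]) = \<infinity>"
    by (simp_all add: proj_def one_tropical_def zero_tropical_def)
  moreover have "vector [1, 0] \<noteq> (0::tropical^2)" "vector [1, 1] \<noteq> (0::tropical^2)"
    "vector [0, 1] \<noteq> (0::tropical^2)"
    by (simp_all add: vec2_nonzero)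
  ultimately show ?thesis
    unfolding PC_eq matrix_vector_mul_lid by (simp; metis)
qed

text \<open>The projection of \<open>(1, t)\<close> is \<open>t\<close> itself, as an extended real.\<close>

lemma endpoints_in_PC_chain_form: "{proj (vector [1, t]), 0} \<subseteq> PC (chain_form t)"
proof -
  have "chain_form t *v vector [1, 0] = vector [1, t]" "chain_form t *v vector [0, 1] = vector [1, 1]"
    by (simp_all add: vec_eq_iff forall_2 mat2_mult_vec chain_form_def)
  moreover have "vector [1, t] \<noteq> (0::tropical^2)" "vector [1, 1] \<noteq> (0::tropical^2)"
    by (simp_all add: vec2_nonzero)
  moreover have "proj (vector [1, 1]) = 0"
    by (simp add: proj_def one_tropical_def)
  ultimately show ?thesis
    unfolding PC_eq by simp metis
qed

lemma PC_chain_form_subset: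
  assumes "s + 1 = 1"
  shows "PC (chain_form s) \<subseteq> {proj (vector [1, s])..0}"
proof -
  have "proj (vector [1, s]) \<le> proj v \<and> proj v \<le> 0"
    if "v = chain_form s *v x" "v \<noteq> 0" for v x
  proof -
    have v: "v $ 1 = x $ 1 + x $ 2" "v $ 2 = s * x $ 1 + x $ 2"
      by (simp_all add: that(1) chain_form_def mat2_mult_vec)
    show ?thesis
      using that(2) assms unfolding vec2_nonzero proj_def v
      by (cases s; cases "x $ 1"; cases "x $ 2")
        (auto simp: one_tropical_def zero_tropical_def max_def split: if_splits)
  qed
  then show ?thesis
    unfolding PC_eq by auto
qed

text \<open>Tropical addition is the maximum, so \<open>s + t = t\<close> says that \<open>s\<close> is at most \<open>t\<close>: the interval of
  the embedded space is no longer than the other. It is enough to see where the two end points go. If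
  \<open>s\<close> is finite, their images are real and at most the length of the target apart.\<close>

lemma chain_form_embedding:
  assumes "s + 1 = 1" and "t + 1 = 1"
    and "embeds_isometrically (PC (chain_form t)) (PC (chain_form s))"
  shows "s + t = t"
proof -
  obtain f where f: "f \<in> PC (chain_form t) \<rightarrow> PC (chain_form s)"
    "\<And>x y. x \<in> PC (chain_form t) \<Longrightarrow> y \<in> PC (chain_form t) \<Longrightarrow> delta (f x) (f y) = delta x y"
    using assms(3) unfolding embeds_isometrically_def by blast
  let ?l = "proj (vector [1, t])"
  have "{f ?l, f 0} \<subseteq> {proj (vector [1, s])..0}"
    using f(1) endpoints_in_PC_chain_form[of t] PC_chain_form_subset[OF assms(1)] by auto
  moreover have "delta (f ?l) (f 0) = delta ?l 0"
    using f(2) endpoints_in_PC_chain_form[of t] by simp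
  ultimately show ?thesis
    using assms(1,2)
    by (cases s; cases t; cases "f ?l"; cases "f 0")
      (auto simp: proj_def one_tropical_def delta_def zero_ereal_def split: if_splits)
qed

text \<open>Two points are at infinite distance only if they differ and one of them is infinite. Below \<open>0\<close>
  there is one infinite point, so at most two points can be pairwise infinitely far apart.\<close>

lemma mat_1_not_embeds_chain_form:
  assumes "s + 1 = 1"
  shows "\<not> embeds_isometrically (PC (mat 1)) (PC (chain_form s))"
proof
  assume "embeds_isometrically (PC (mat 1)) (PC (chain_form s))"
  then obtain f where f: "f \<in> PC (mat 1) \<rightarrow> PC (chain_form s)"
    "\<And>x y. x \<in> PC (mat 1) \<Longrightarrow> y \<in> PC (mat 1) \<Longrightarrow> delta (f x) (f y) = delta x y"
    unfolding embeds_isometrically_def by blast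
  have "f x \<le> 0" if "x \<in> PC (mat 1)" for x
    using f(1) PC_chain_form_subset[OF assms] that by fastforce
  then have "f (- \<infinity>) \<le> 0" "f 0 \<le> 0" "f \<infinity> \<le> 0"
    using infinite_points_in_PC_mat_1 by auto
  moreover have "delta (f (- \<infinity>)) (f 0) = \<infinity>" "delta (f 0) (f \<infinity>) = \<infinity>"
    "delta (f (- \<infinity>)) (f \<infinity>) = \<infinity>"
    using infinite_points_in_PC_mat_1 by (simp_all add: f(2)) (simp_all add: delta_def zero_ereal_def)
  ultimately show False
    by (cases "f (- \<infinity>)"; cases "f 0"; cases "f \<infinity>") (auto simp: delta_def)
qed

section \<open>Characterising the order\<close>

text \<open>Reversing the order of both rows and columns turns the transpose of a \<open>chain_form\<close> back into
  the matrix, so every matrix is equivalent to its transpose.\<close>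

lemma PC_PR_mutually_embed:
  "embeds_isometrically (PC A) (PR A) \<and> embeds_isometrically (PR A) (PC A)"
proof -
  have "A \<sim> transpose A"
  proof (cases rule: normal_form[of A])
    case 1
    then show ?thesis
      by (simp add: zero_eq_mat2 transpose_mat2 equivalent_refl)
  next
    case 2
    also have "mat 1 \<sim> transpose A"
      using equivalent_transpose[OF equivalent_sym[OF 2]] by simp
    finally show ?thesis .
  next
    case (3 t)
    note 3(2)
    also have "chain_form t \<sim> mat2 1 1 1 t"
      unfolding chain_form_def by (rule equivalent_swap_columns)
    also have "mat2 1 1 1 t \<sim> mat2 1 t 1 1"
      by (rule equivalent_swap_rows)
    also have "\<dots> = transpose (chain_form t)"
      by (simp add: chain_form_def transpose_mat2)
    also have "\<dots> \<sim> transpose A"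
      by (rule equivalent_transpose[OF equivalent_sym[OF 3(2)]])
    finally show ?thesis .
  qed
  then show ?thesis
    unfolding equivalent_def below_def PR_eq_PC_transpose by simp
qed

text \<open>Right multiplication passes to a subset of the column space. Left multiplication may collapse
  the column space, but it passes to a subset of the row space, and the row and column spaces of a
  single matrix embed in each other.\<close>

lemma PC_embeds_if_J_le:
  assumes "J_le A B"
  shows "embeds_isometrically (PC A) (PC B)"
proof -
  obtain P Q where A: "A = P ** B ** Q"
    using assms unfolding J_le_iff by blast
  have "embeds_isometrically (PC A) (PC (P ** B))"
    unfolding A by (intro embeds_isometrically_subset PC_mult_subset)
  also have "embeds_isometrically (PC (P ** B)) (PR (P ** B))"
    by (simp add: PC_PR_mutually_embed)
  also have "embeds_isometrically (PR (P ** B)) (PR B)"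
    by (intro embeds_isometrically_subset PR_mult_subset)
  also have "embeds_isometrically (PR B) (PC B)"
    by (simp add: PC_PR_mutually_embed)
  finally show ?thesis .
qed

lemma J_le_if_PC_embeds:
  assumes "embeds_isometrically (PC A) (PC B)"
  shows "J_le A B"
proof -
  have reduce: "J_le A B"
    if "A \<sim> M" "B \<sim> N" "embeds_isometrically (PC M) (PC N) \<Longrightarrow> J_le M N" for M N
  proof -
    have "embeds_isometrically (PC M) (PC A)"
      using that(1) by (simp add: equivalent_def below_def)
    also note assms
    also have "embeds_isometrically (PC B) (PC N)"
      using that(2) by (simp add: equivalent_def below_def)
    finally have "J_le M N"
      by (rule that(3))
    have "J_le A M"
      using that(1) by (simp add: equivalent_def below_def)
    also note \<open>J_le M N\<close>
    also have "J_le N B"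
      using that(2) by (simp add: equivalent_def below_def)
    finally show ?thesis .
  qed
  have J0: "J_le 0 N" and J1: "J_le N (mat 1)" for N :: "tropical^2^2"
    using J_le_mult[of 0 N 0] J_le_mult[of N "mat 1" "mat 1"] by simp_all
  have empty: "M = {}" if "embeds_isometrically M {}" for M
    using that by (auto simp: embeds_isometrically_def)
  have PC: "PC (mat 1) \<noteq> {}" "PC (chain_form t) \<noteq> {}" for t
    using infinite_points_in_PC_mat_1 endpoints_in_PC_chain_form[of t] by auto
  show ?thesis
  proof (cases rule: normal_form[of A])
    case 1
    then show ?thesis
      by (simp add: J0)
  next
    case A: 2
    show ?thesis
    proof (cases rule: normal_form[of B])
      case 1
      then show ?thesis
        using reduce[OF A equivalent_refl] empty PC by (auto simp: PC_zero)
    next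
      case 2
      then show ?thesis
        using reduce[OF A 2] J1 by blast
    next
      case (3 s)
      then show ?thesis
        using reduce[OF A 3(2)] mat_1_not_embeds_chain_form by blast
    qed
  next
    case A: (3 t)
    show ?thesis
    proof (cases rule: normal_form[of B])
      case 1
      then show ?thesis
        using reduce[OF A(2) equivalent_refl] empty PC by (auto simp: PC_zero)
    next
      case 2
      then show ?thesis
        using reduce[OF A(2) 2] J1 by blast
    next
      case (3 s)
      show ?thesis
      proof (rule reduce[OF A(2) 3(2)])
        assume "embeds_isometrically (PC (chain_form t)) (PC (chain_form s))"
        then have "s + t = t"
          by (rule chain_form_embedding[OF 3(1) A(1)])
        \<comment> \<open>The second columns agree; the first is \<open>(1, t) = (1, s) + t * (1, 1)\<close>.\<close>
        then have "chain_form t = mat 1 ** chain_form s ** mat2 1 0 t 1"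
          using A(1) by (simp add: chain_form_def mat2_mult add.commute)
        then show "J_le (chain_form t) (chain_form s)"
          unfolding J_le_iff by blast
      qed
    qed
  qed
qed

theorem theorem3p6:
  fixes A B :: "tropical^2^2"
  shows "(J_le A B \<longleftrightarrow> embeds_isometrically (PC A) (PC B)) \<and>
         (J_le A B \<longleftrightarrow> embeds_isometrically (PR A) (PR B))"
proof -
  have "J_le A B \<longleftrightarrow> embeds_isometrically (PC A) (PC B)"
    using PC_embeds_if_J_le J_le_if_PC_embeds by blast
  moreover have "embeds_isometrically (PR A) (PR B)" if "embeds_isometrically (PC A) (PC B)"
    using embeds_isometrically_trans[OF embeds_isometrically_trans[OF _ that]]
      PC_PR_mutually_embed[of A] PC_PR_mutually_embed[of B] by simp
  moreover have "embeds_isometrically (PC A) (PC B)" if "embeds_isometrically (PR A) (PR B)"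
    using embeds_isometrically_trans[OF embeds_isometrically_trans[OF _ that]]
      PC_PR_mutually_embed[of A] PC_PR_mutually_embed[of B] by simp
  ultimately show ?thesis
    by blast
qed

end
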